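(* There is a constant $c>0$ such that for all integers $n\ge 0$ and all integers $N>n$, $$H_{U_n,N}(y_n)\ge c\,n^{1/2}.$$
   Context: $\mathcal{H}=\{(x_1,x_2)\in\mathbb{Z}^2: x_2\ge 0\}$; for each integer $n\ge0$, $L_n=\{(k,n):k\in\mathbb{Z}\}$, $V_n=\{(0,k):0\le k\le n\}$, $U_n=L_0\cup V_n$, and $y_n=(0,n)$. $(S_n)_{n\ge 0}$ is simple random walk on $\mathbb{Z}^2$, $P_z$ is its law when $S_0=z$, and for $A\subset\mathbb{Z}^2$, $\bar\tau_A=\min\{n\ge 0:S_n\in A\}$. For $B\subset\mathcal{H}$, $x\in B$ and an integer $N\geq 1$, $$H_{B,N}(x)=\sum_{z\in L_N\setminus B}P_z\big(S_{\bar\tau_{B\cup L_0}}=x\big).$$ *)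

theory Defs
  imports "HOL-Probability.Probability"
begin

definition upper_half_lattice :: "(int \<times> int) set" where
  "upper_half_lattice = {(x1, x2). x2 \<ge> 0}"

definition L_line :: "nat \<Rightarrow> (int \<times> int) set" where
  "L_line n = {(k, int n) | k. True}"

definition V_seg :: "nat \<Rightarrow> (int \<times> int) set" where
  "V_seg n = {(0, int k) | k. k \<le> n}"

definition U_set :: "nat \<Rightarrow> (int \<times> int) set" where
  "U_set n = L_line 0 \<union> V_seg n"

definition y_tip :: "nat \<Rightarrow> int \<times> int" where
  "y_tip n = (0, int n)"

definition srw_step :: "(int \<times> int) pmf" where
  "srw_step = pmf_of_set {(1, 0), (-1, 0), (0, 1), (0, -1)}"

text \<open>
  The law \<open>P\<^sub>z\<close>, realised as a measure on path space: the trajectory is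
  the start \<open>z\<close> plus the partial sums of i.i.d. uniform unit steps.
\<close>

definition srw :: "int \<times> int \<Rightarrow> (nat \<Rightarrow> int \<times> int) measure" where
  "srw z = distr (\<Pi>\<^sub>M i\<in>(UNIV :: nat set). measure_pmf srw_step)
                 (\<Pi>\<^sub>M i\<in>(UNIV :: nat set). count_space UNIV)
                 (\<lambda>\<xi> n. z + (\<Sum>i<n. \<xi> i))"

text \<open>Time \<open>0\<close> counts; the value is \<open>\<infinity>\<close> if the path never meets \<open>A\<close>.\<close>

definition hitting_time :: "(int \<times> int) set \<Rightarrow> (nat \<Rightarrow> int \<times> int) \<Rightarrow> enat" where
  "hitting_time A S = Inf (enat ` {n. S n \<in> A})"

text \<open>
  The sum is taken in \<open>[0, \<infinity>]\<close>, so no summability is presupposed. The intended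
  arguments are \<open>B \<subseteq> upper_half_lattice\<close>, \<open>x \<in> B\<close> and \<open>N \<ge> 1\<close>.
\<close>

definition H_sum :: "(int \<times> int) set \<Rightarrow> nat \<Rightarrow> int \<times> int \<Rightarrow> ennreal" where
  "H_sum B N x = (\<Sum>\<^sub>\<infinity>z\<in>L_line N - B.
     emeasure (srw z) {S \<in> space (srw z).
       hitting_time (B \<union> L_line 0) S < \<infinity> \<and> S (the_enat (hitting_time (B \<union> L_line 0) S)) = x})"

lemma U_set_subset_upper_half_lattice: "U_set n \<subseteq> upper_half_lattice"
  by (auto simp: U_set_def L_line_def V_seg_def upper_half_lattice_def)

lemma y_tip_in_U_set: "y_tip n \<in> U_set n"
  by (auto simp: U_set_def V_seg_def y_tip_def)

lemma measurable_srw_path: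
  "(\<lambda>\<xi> n. z + (\<Sum>i<n. \<xi> i))
     \<in> (\<Pi>\<^sub>M i\<in>(UNIV :: nat set). measure_pmf srw_step)
       \<rightarrow>\<^sub>M (\<Pi>\<^sub>M i\<in>(UNIV :: nat set). count_space (UNIV :: (int \<times> int) set))"
proof -
  let ?M = "\<Pi>\<^sub>M i\<in>(UNIV :: nat set). measure_pmf srw_step"
  have comp: "(\<lambda>\<xi>. \<xi> i) \<in> ?M \<rightarrow>\<^sub>M count_space UNIV" for i :: nat
    using measurable_component_singleton[of i UNIV "\<lambda>_. measure_pmf srw_step"] by simp
  have "(\<lambda>\<xi>. z + (\<Sum>i<n. \<xi> i)) \<in> ?M \<rightarrow>\<^sub>M count_space UNIV" for n :: nat
  proof (induction n)
    case 0
    show ?case by simp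
  next
    case (Suc n)
    have "(\<lambda>\<xi>. (\<lambda>a \<xi>. a + \<xi> n) (z + (\<Sum>i<n. \<xi> i)) \<xi>) \<in> ?M \<rightarrow>\<^sub>M count_space UNIV"
      by (rule measurable_compose_countable[OF _ Suc], rule measurable_compose[OF comp]) simp
    then show ?case
      by (simp only: lessThan_Suc sum.insert finite_lessThan lessThan_iff less_irrefl
          not_False_eq_True ac_simps)
  qed
  then show ?thesis
    by (intro measurable_PiM_single') (simp_all add: space_PiM)
qed

lemma prob_space_srw: "prob_space (srw z)"
proof -
  have "prob_space (\<Pi>\<^sub>M i\<in>(UNIV :: nat set). measure_pmf srw_step)"
    by (intro prob_space_PiM prob_space_measure_pmf)
  then show ?thesis
    unfolding srw_def by (rule prob_space.prob_space_distr[OF _ measurable_srw_path])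
qed

lemma hitting_time_eq_enat:
  assumes "S k \<in> A" and "\<And>m. m < k \<Longrightarrow> S m \<notin> A"
  shows "hitting_time A S = enat k"
  unfolding hitting_time_def
proof (rule antisym)
  show "Inf (enat ` {n. S n \<in> A}) \<le> enat k"
    using assms(1) by (intro Inf_lower) simp
  show "enat k \<le> Inf (enat ` {n. S n \<in> A})"
  proof (rule Inf_greatest)
    fix t assume "t \<in> enat ` {n. S n \<in> A}"
    then obtain n where t: "t = enat n" and n: "S n \<in> A" by blast
    have "k \<le> n"
    proof (rule ccontr)
      assume "\<not> k \<le> n"
      then show False using assms(2)[of n] n by simp
    qed
    then show "enat k \<le> t"
      by (simp only: t enat_ord_simps)
  qed
qed

lemma hitting_event_eq:
  "hitting_time A S < \<infinity> \<and> S (the_enat (hitting_time A S)) = x \<longleftrightarrow>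
     (\<exists>n. S n = x \<and> S n \<in> A \<and> (\<forall>m<n. S m \<notin> A))" (is "?l \<longleftrightarrow> ?r")
proof
  assume ?r
  then obtain n where n: "S n = x" "S n \<in> A" "\<And>m. m < n \<Longrightarrow> S m \<notin> A"
    by blast
  have "hitting_time A S = enat n"
    using n(2,3) by (rule hitting_time_eq_enat)
  then show ?l
    by (simp add: n(1))
next
  assume l: ?l
  have "\<exists>n. S n \<in> A"
  proof (rule ccontr)
    assume "\<not> (\<exists>n. S n \<in> A)"
    then have "hitting_time A S = \<infinity>"
      by (simp add: hitting_time_def top_enat_def)
    with l show False by simp
  qed
  then obtain n where n: "S n \<in> A" "\<And>m. m < n \<Longrightarrow> S m \<notin> A"
    unfolding exists_least_iff[of "\<lambda>n. S n \<in> A"] by blast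
  have "hitting_time A S = enat n"
    using n by (rule hitting_time_eq_enat)
  with l have "S n = x"
    by simp
  with n show ?r by blast
qed

lemma hitting_event_measurable:
  "{S \<in> space (srw z). hitting_time A S < \<infinity> \<and> S (the_enat (hitting_time A S)) = x}
     \<in> sets (srw z)"
proof -
  have comp: "(\<lambda>S. S i) \<in> srw z \<rightarrow>\<^sub>M count_space UNIV" for i
    unfolding srw_def by simp
  have sets: "{S \<in> space (srw z). S i \<in> C} \<in> sets (srw z)" for i C
    using measurable_sets[OF comp, of C i] by (simp add: vimage_def Int_def conj_commute)
  have "{S \<in> space (srw z). \<exists>n. S n \<in> {x} \<and> S n \<in> A \<and> (\<forall>m\<in>{..<n}. S m \<in> - A)} \<in> sets (srw z)"
    by (intro sets.sets_Collect_countable_Ex sets.sets_Collect_conj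
        sets.sets_Collect_finite_All sets finite_lessThan)
  then show ?thesis
    unfolding hitting_event_eq by (simp add: Ball_def)
qed

end

theory Submission imports Defs begin

text \<open>
  Let \<open>v n\<close> be the expected height at which the walk, killed on leaving a large finite box over
  \<open>L_line 0\<close>, hits the slit \<open>V_seg n\<close>, and let \<open>a n = n + 1 - v n (0, n + 1)\<close>. Translating the
  slit shows that \<open>a\<close> is nondecreasing. By orthogonality, the Dirichlet energy of \<open>v n\<close> is
  \<open>\<Sum>k<n. a k * \<mu> (k + 1)\<close>, where \<open>\<mu> k\<close> is the flux of \<open>v k\<close> out of the tip, and
  \<open>\<mu> k \<le> 33 * a k\<close> by Harnack's inequality. Edge-disjoint paths from the slit to the axis bound
  the energy below by \<open>n\<^sup>2 / 4\<close>, so \<open>33 * n * (a n)\<^sup>2 \<ge> n\<^sup>2 / 4\<close>, i.e. \<open>a n\<close> is at least of order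
  \<open>sqrt n\<close>, uniformly in the box.

  To pass to the walk, test the hitting probability \<open>F\<close> of the tip against
  \<open>\<psi> = max 0 (\<beta> - v n)\<close>, where \<open>\<beta>\<close> is at most the height on the slit, at least the height at
  \<open>(0, n + 1)\<close>, nonpositive around the box, and harmonic except for a kink on \<open>L_line N\<close>. Green's identity gives
  \<open>\<psi> (0, n + 1) \<le> 2 * (\<Sum>z\<in>L_line N. F z)\<close>, and the left side is at least \<open>a n\<close>.
\<close>

section \<open>The lattice Laplacian\<close>

text \<open>Unnormalised, with the sign for which superharmonic functions have nonnegative values
  and \<open>dirichlet_form\<close> yields sums of squares.\<close>

definition neg_lap :: "(int \<times> int \<Rightarrow> real) \<Rightarrow> int \<times> int \<Rightarrow> real" where
  "neg_lap f x = 4 * f x - (f (x + (1, 0)) + f (x - (1, 0)) + f (x + (0, 1)) + f (x - (0, 1)))"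

lemma neg_lap_Pair:
  "neg_lap f (i, j) = 4 * f (i, j) - (f (i + 1, j) + f (i - 1, j) + f (i, j + 1) + f (i, j - 1))"
  by (simp add: neg_lap_def)

section \<open>Sums over the lattice and summation by parts\<close>

lemma finite_support_summable:
  fixes f :: "'a \<Rightarrow> real"
  assumes "finite A" "\<And>x. x \<notin> A \<Longrightarrow> f x = 0"
  shows "f summable_on UNIV"
  using assms summable_on_cong_neutral[of UNIV A f f] by auto

lemma summable_on_minus:
  fixes f g :: "'a \<Rightarrow> real"
  assumes "f summable_on A" "g summable_on A"
  shows "(\<lambda>x. f x - g x) summable_on A"
  using summable_on_add[OF assms(1), of "\<lambda>x. - g x"] assms(2) by (simp add: summable_on_uminus)

lemma infsum_minus:
  fixes f g :: "'a \<Rightarrow> real"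
  assumes "f summable_on A" "g summable_on A"
  shows "(\<Sum>\<^sub>\<infinity>x\<in>A. f x - g x) = infsum f A - infsum g A"
  using infsum_add[OF assms(1), of "\<lambda>x. - g x"] assms(2)
  by (simp add: summable_on_uminus infsum_uminus)

lemma infsum_translate:
  fixes f :: "int \<times> int \<Rightarrow> real"
  shows "(\<Sum>\<^sub>\<infinity>x. f (x + e)) = (\<Sum>\<^sub>\<infinity>x. f x)"
proof -
  have "bij (\<lambda>x. x + e)"
    by (rule bij_betw_byWitness[where f' = "\<lambda>x. x - e"]) auto
  then show ?thesis
    by (rule infsum_reindex_bij_betw)
qed

lemma summable_translate:
  fixes f :: "int \<times> int \<Rightarrow> real"
  assumes "f summable_on UNIV"
  shows "(\<lambda>x. f (x + e)) summable_on UNIV"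
proof -
  have "bij (\<lambda>x. x + e)"
    by (rule bij_betw_byWitness[where f' = "\<lambda>x. x - e"]) auto
  then show ?thesis
    using assms summable_on_reindex_bij_betw[of "\<lambda>x. x + e" UNIV UNIV f] by simp
qed

lemma green_shift:
  fixes f g :: "int \<times> int \<Rightarrow> real"
  shows "(\<Sum>\<^sub>\<infinity>x. f x * g (x + e)) = (\<Sum>\<^sub>\<infinity>x. g x * f (x - e))"
    and "(\<Sum>\<^sub>\<infinity>x. f x * g (x - e)) = (\<Sum>\<^sub>\<infinity>x. g x * f (x + e))"
  using infsum_translate[of "\<lambda>x. g x * f (x - e)" e] infsum_translate[of "\<lambda>x. f x * g (x - e)" e]
  by (simp_all add: mult.commute)

lemma summable_neg_lap_mult:
  fixes f g :: "int \<times> int \<Rightarrow> real"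
  assumes A: "finite A" "\<And>x. x \<notin> A \<Longrightarrow> f x = 0"
  shows "(\<lambda>x. g x * neg_lap f x) summable_on UNIV"
proof -
  let ?B = "A \<union> (\<lambda>x. x - (1, 0)) ` A \<union> (\<lambda>x. x + (1, 0)) ` A
              \<union> (\<lambda>x. x - (0, 1)) ` A \<union> (\<lambda>x. x + (0, 1)) ` A"
  have "neg_lap f x = 0" if "x \<notin> ?B" for x
  proof -
    have "x \<notin> A" using that by auto
    moreover have "x + (1, 0) \<notin> A"
      using that by (metis (no_types, lifting) UnI1 UnI2 add_diff_cancel image_eqI)
    moreover have "x - (1, 0) \<notin> A"
      using that by (metis (no_types, lifting) UnI1 UnI2 diff_add_cancel image_eqI)
    moreover have "x + (0, 1) \<notin> A"
      using that by (metis (no_types, lifting) UnI1 UnI2 add_diff_cancel image_eqI)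
    moreover have "x - (0, 1) \<notin> A"
      using that by (metis (no_types, lifting) UnI1 UnI2 diff_add_cancel image_eqI)
    ultimately show ?thesis
      unfolding neg_lap_def by (simp add: A(2))
  qed
  then show ?thesis
    using A(1) by (intro finite_support_summable[of ?B]) auto
qed

lemma infsum_mult_neg_lap:
  assumes s: "\<And>e. (\<lambda>x. g x * f (x + e)) summable_on UNIV"
  shows "(\<Sum>\<^sub>\<infinity>x. g x * neg_lap f x) =
      4 * (\<Sum>\<^sub>\<infinity>x. g x * f x) - ((\<Sum>\<^sub>\<infinity>x. g x * f (x + (1, 0))) + (\<Sum>\<^sub>\<infinity>x. g x * f (x - (1, 0)))
       + (\<Sum>\<^sub>\<infinity>x. g x * f (x + (0, 1))) + (\<Sum>\<^sub>\<infinity>x. g x * f (x - (0, 1))))"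
proof (rule infsumI)
  have t: "((\<lambda>x. g x * f (x + e)) has_sum (\<Sum>\<^sub>\<infinity>x. g x * f (x + e))) UNIV" for e
    using s by (rule has_sum_infsum)
  have eq: "(\<lambda>x. g x * neg_lap f x) = (\<lambda>x. 4 * (g x * f (x + 0)) + (- 1) * (g x * f (x + (1, 0))
      + g x * f (x + - (1, 0)) + g x * f (x + (0, 1)) + g x * f (x + - (0, 1))))"
    by (auto simp: neg_lap_def algebra_simps)
  have "((\<lambda>x. g x * neg_lap f x) has_sum
      (4 * (\<Sum>\<^sub>\<infinity>x. g x * f (x + 0)) + (- 1) * ((\<Sum>\<^sub>\<infinity>x. g x * f (x + (1, 0))) + (\<Sum>\<^sub>\<infinity>x. g x * f (x + - (1, 0)))
       + (\<Sum>\<^sub>\<infinity>x. g x * f (x + (0, 1))) + (\<Sum>\<^sub>\<infinity>x. g x * f (x + - (0, 1)))))) UNIV"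
    unfolding eq by (rule has_sum_add has_sum_cmult_right t)+
  moreover have eq1: "x - (1, 0) = x + (- 1, 0)" "x - (0, 1) = x + (0, - 1)" for x :: "int \<times> int"
    by (cases x; simp)+
  ultimately show "((\<lambda>x. g x * neg_lap f x) has_sum
      (4 * (\<Sum>\<^sub>\<infinity>x. g x * f x) - ((\<Sum>\<^sub>\<infinity>x. g x * f (x + (1, 0))) + (\<Sum>\<^sub>\<infinity>x. g x * f (x - (1, 0)))
       + (\<Sum>\<^sub>\<infinity>x. g x * f (x + (0, 1))) + (\<Sum>\<^sub>\<infinity>x. g x * f (x - (0, 1)))))) UNIV"
    by (simp add: eq1 algebra_simps)
qed

text \<open>Each neighbour shift moves from one factor to the other by translation invariance of the
  sum. Finite support of \<open>f\<close> makes every sum converge, so \<open>g\<close> may be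
  arbitrary, such as a hitting probability.\<close>

lemma green_identity:
  fixes f g :: "int \<times> int \<Rightarrow> real"
  assumes A: "finite A" "\<And>x. x \<notin> A \<Longrightarrow> f x = 0"
  shows "(\<Sum>\<^sub>\<infinity>x. f x * neg_lap g x) = (\<Sum>\<^sub>\<infinity>x. g x * neg_lap f x)"
proof -
  have s: "(\<lambda>x. f x * k x) summable_on UNIV" for k
    using A by (intro finite_support_summable[of A]) auto
  have t: "(\<lambda>x. g x * f (x + e)) summable_on UNIV" for e
    using summable_translate[OF s[of "\<lambda>x. g (x - e)"], of e] by (simp add: mult.commute)
  show ?thesis
    unfolding infsum_mult_neg_lap[of f g, OF s] infsum_mult_neg_lap[of g f, OF t] green_shift[of f g]
    by (simp add: mult.commute)
qed

text \<open>Expand the squares and translate the shifted ones back. With only the steps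
  \<open>(1, 0)\<close> and \<open>(0, 1)\<close>, each undirected edge is counted once.\<close>

lemma dirichlet_form:
  fixes f :: "int \<times> int \<Rightarrow> real"
  assumes A: "finite A" "\<And>x. x \<notin> A \<Longrightarrow> f x = 0"
  shows "(\<Sum>\<^sub>\<infinity>x. f x * neg_lap f x) =
    (\<Sum>\<^sub>\<infinity>x. (f x - f (x + (1, 0)))\<^sup>2) + (\<Sum>\<^sub>\<infinity>x. (f x - f (x + (0, 1)))\<^sup>2)"
    and "(\<lambda>x. (f x - f (x + e))\<^sup>2) summable_on UNIV"
proof -
  have s: "(\<lambda>x. f x * k x) summable_on UNIV" for k
    using A by (intro finite_support_summable[of A]) auto
  have t: "(\<lambda>x. f (x + e) * f (x + e)) summable_on UNIV" for e
    using summable_translate[OF s[of f]] .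
  have expand: "(\<lambda>x. (f x - f (x + e))\<^sup>2) =
      (\<lambda>x. f x * f x + f (x + e) * f (x + e) - 2 * (f x * f (x + e)))" for e
    by (auto simp: power2_eq_square algebra_simps)
  show "(\<lambda>x. (f x - f (x + e))\<^sup>2) summable_on UNIV" for e
    unfolding expand by (intro summable_on_minus summable_on_add summable_on_cmult_right s t)
  have sq: "(\<Sum>\<^sub>\<infinity>x. (f x - f (x + e))\<^sup>2) = 2 * (\<Sum>\<^sub>\<infinity>x. f x * f x)
      - ((\<Sum>\<^sub>\<infinity>x. f x * f (x + e)) + (\<Sum>\<^sub>\<infinity>x. f x * f (x - e)))" for e
    unfolding expand
    by (subst infsum_minus infsum_add infsum_cmult_right;
        (intro summable_on_add summable_on_cmult_right s t)?)+
      (simp add: infsum_translate[of "\<lambda>x. f x * f x"] green_shift(2)[of f f])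
  from infsum_mult_neg_lap[of f f, OF s] sq[of "(1, 0)"] sq[of "(0, 1)"]
  show "(\<Sum>\<^sub>\<infinity>x. f x * neg_lap f x) =
    (\<Sum>\<^sub>\<infinity>x. (f x - f (x + (1, 0)))\<^sup>2) + (\<Sum>\<^sub>\<infinity>x. (f x - f (x + (0, 1)))\<^sup>2)"
    by simp
qed

section \<open>Hitting probabilities\<close>

definition hit_prob :: "(int \<times> int) set \<Rightarrow> int \<times> int \<Rightarrow> int \<times> int \<Rightarrow> ennreal" where
  "hit_prob A x z = emeasure (srw z) {S \<in> space (srw z).
     hitting_time A S < \<infinity> \<and> S (the_enat (hitting_time A S)) = x}"

definition steps :: "(nat \<Rightarrow> int \<times> int) measure" where
  "steps = (\<Pi>\<^sub>M i\<in>(UNIV :: nat set). measure_pmf srw_step)"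

definition walk :: "int \<times> int \<Rightarrow> (nat \<Rightarrow> int \<times> int) \<Rightarrow> nat \<Rightarrow> int \<times> int" where
  "walk z \<xi> = (\<lambda>n. z + (\<Sum>i<n. \<xi> i))"

text \<open>Pulled back from paths to step sequences and freed of \<open>hitting_time\<close>, so
  that the first step can be split off with \<open>case_nat\<close>.\<close>

definition hit_event :: "(int \<times> int) set \<Rightarrow> int \<times> int \<Rightarrow> int \<times> int \<Rightarrow> (nat \<Rightarrow> int \<times> int) set" where
  "hit_event A x z =
     {\<xi>. \<exists>n. walk z \<xi> n = x \<and> walk z \<xi> n \<in> A \<and> (\<forall>m<n. walk z \<xi> m \<notin> A)}"

lemma hit_prob_eq: "hit_prob A x z = emeasure steps (hit_event A x z)"
  and sets_hit_event: "hit_event A x z \<in> sets steps"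
proof -
  let ?X = "{S \<in> space (srw z). hitting_time A S < \<infinity> \<and> S (the_enat (hitting_time A S)) = x}"
  have sp: "space (srw z) = UNIV" "space steps = UNIV"
    by (auto simp: srw_def steps_def space_PiM)
  have m: "walk z \<in> steps \<rightarrow>\<^sub>M (\<Pi>\<^sub>M i\<in>(UNIV :: nat set). count_space UNIV)"
    using measurable_srw_path[of z] unfolding walk_def[abs_def] steps_def .
  have srw: "srw z = distr steps (\<Pi>\<^sub>M i\<in>(UNIV :: nat set). count_space UNIV) (walk z)"
    unfolding srw_def steps_def walk_def[abs_def] ..
  have pre: "walk z -` ?X \<inter> space steps = hit_event A x z"
    unfolding hitting_event_eq hit_event_def sp by auto
  have X: "?X \<in> sets (\<Pi>\<^sub>M i\<in>(UNIV :: nat set). count_space UNIV)"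
    using hitting_event_measurable[of z A x] by (simp add: srw)
  show "hit_prob A x z = emeasure steps (hit_event A x z)"
    unfolding hit_prob_def pre[symmetric] srw by (rule emeasure_distr[OF m X[unfolded srw]])
  show "hit_event A x z \<in> sets steps"
    unfolding pre[symmetric] using m X by (rule measurable_sets)
qed

lemma walk_case_nat:
  "walk z (case_nat s \<xi>) 0 = z" "walk z (case_nat s \<xi>) (Suc n) = walk (z + s) \<xi> n"
  unfolding walk_def by (simp_all add: sum.lessThan_Suc_shift add.assoc del: sum.lessThan_Suc)

lemma hit_event_case_nat:
  assumes "z \<notin> A"
  shows "case_nat s \<xi> \<in> hit_event A x z \<longleftrightarrow> \<xi> \<in> hit_event A x (z + s)"
proof -
  have "(\<exists>n. P n) \<longleftrightarrow> P 0 \<or> (\<exists>n. P (Suc n))" for P :: "nat \<Rightarrow> bool"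
    by (metis not0_implies_Suc)
  note Ex_Suc = this[of "\<lambda>n. walk z (case_nat s \<xi>) n = x \<and> walk z (case_nat s \<xi>) n \<in> A
    \<and> (\<forall>m<n. walk z (case_nat s \<xi>) m \<notin> A)"]
  show ?thesis
    unfolding hit_event_def mem_Collect_eq Ex_Suc All_less_Suc2 walk_case_nat
    using assms by simp
qed

interpretation step_seq: sequence_space "measure_pmf srw_step" ..

text \<open>I.i.d. steps have the law of one step followed by an independent fresh sequence. As
  \<open>z\<close> is not in \<open>A\<close>, nothing is hit at time 0, so integrating over the
  first step restarts the walk at \<open>z + s\<close>.\<close>

lemma hit_prob_harmonic:
  assumes z: "z \<notin> A"
  shows "hit_prob A x z = (\<integral>\<^sup>+ s. hit_prob A x (z + s) \<partial>measure_pmf srw_step)"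
proof -
  let ?M = "measure_pmf srw_step"
  have steps: "steps = distr (?M \<Otimes>\<^sub>M steps) steps (\<lambda>(s, \<xi>). case_nat s \<xi>)"
    unfolding steps_def using step_seq.PiM_iter by simp
  have m: "(\<lambda>(s, \<xi>). case_nat s \<xi>) \<in> ?M \<Otimes>\<^sub>M steps \<rightarrow>\<^sub>M steps"
    unfolding steps_def by measurable
  interpret S: sigma_finite_measure steps
    unfolding steps_def by unfold_locales
  let ?Y = "(\<lambda>(s, \<xi>). case_nat s \<xi>) -` hit_event A x z \<inter> space (?M \<Otimes>\<^sub>M steps)"
  have Y: "Pair s -` ?Y = hit_event A x (z + s)" for s
    by (auto simp: hit_event_case_nat[OF z] space_pair_measure steps_def space_PiM)
  have "hit_prob A x z = emeasure (?M \<Otimes>\<^sub>M steps) ?Y"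
    unfolding hit_prob_eq by (subst steps) (rule emeasure_distr[OF m sets_hit_event])
  also have "\<dots> = (\<integral>\<^sup>+ s. emeasure steps (Pair s -` ?Y) \<partial>?M)"
    by (rule S.emeasure_pair_measure_alt) (rule measurable_sets[OF m sets_hit_event])
  finally show ?thesis
    unfolding Y hit_prob_eq .
qed

lemma nn_integral_srw_step:
  "(\<integral>\<^sup>+ s. g s \<partial>measure_pmf srw_step) = (g (1, 0) + g (-1, 0) + g (0, 1) + g (0, -1)) / 4"
  unfolding srw_step_def by (subst nn_integral_pmf_of_set) (simp_all add: add.assoc)

lemma hit_prob_le_1: "hit_prob A x z \<le> 1"
  unfolding hit_prob_def by (rule prob_space.emeasure_le_1[OF prob_space_srw])

lemma enn2real_hit_prob_harmonic:
  fixes A x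
  defines "F \<equiv> \<lambda>w. enn2real (hit_prob A x w)"
  assumes z: "z \<notin> A"
  shows "F (z + (1, 0)) + F (z - (1, 0)) + F (z + (0, 1)) + F (z - (0, 1)) = 4 * F z"
proof -
  have fin: "hit_prob A x w = ennreal (F w)" "0 \<le> F w" for w
    using hit_prob_le_1[of A x w] unfolding F_def
    by (auto simp: ennreal_enn2real_if top_unique)
  have "ennreal (F z) = ennreal ((F (z + (1, 0)) + F (z - (1, 0)) + F (z + (0, 1)) + F (z - (0, 1))) / 4)"
    using hit_prob_harmonic[OF z, of x] unfolding nn_integral_srw_step fin(1)
    by (cases z) (simp add: fin(2) flip: ennreal_plus ennreal_numeral divide_ennreal)
  then show ?thesis
    by (subst (asm) ennreal_inj) (auto simp: fin(2) intro!: add_nonneg_nonneg)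
qed

lemma hit_prob_self:
  assumes "x \<in> A"
  shows "hit_prob A x x = 1"
proof -
  have "\<xi> \<in> hit_event A x x" for \<xi>
    unfolding hit_event_def walk_def using assms by (auto intro!: exI[of _ 0])
  then have "hit_event A x x = space steps"
    by (auto simp: steps_def space_PiM)
  moreover have "prob_space steps"
    unfolding steps_def by (intro prob_space_PiM prob_space_measure_pmf)
  ultimately show ?thesis
    unfolding hit_prob_eq by (simp add: prob_space.emeasure_space_1)
qed

section \<open>Hitting heights of the slit\<close>

text \<open>The Knaster-Tarski argument: the pointwise infimum \<open>v\<close> of the nonnegative
  supersolutions, of which \<open>u0\<close> is one, is a supersolution by monotonicity; then so is
  \<open>T v\<close>, whence \<open>v \<le> T v\<close>.\<close>

lemma least_fixed_point:
  fixes T :: "('a \<Rightarrow> real) \<Rightarrow> 'a \<Rightarrow> real"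
  assumes mono: "\<And>u w x. (\<And>x. u x \<le> w x) \<Longrightarrow> T u x \<le> T w x"
    and nonneg: "\<And>u x. (\<And>x. 0 \<le> u x) \<Longrightarrow> 0 \<le> T u x"
    and super: "\<And>x. 0 \<le> u0 x" "\<And>x. T u0 x \<le> u0 x"
  defines "v \<equiv> \<lambda>x. Inf {u x | u. \<forall>y. 0 \<le> u y \<and> T u y \<le> u y}"
  shows "0 \<le> v x" and "T v x = v x"
    and "\<And>u. (\<And>y. 0 \<le> u y) \<Longrightarrow> (\<And>y. T u y \<le> u y) \<Longrightarrow> v x \<le> u x"
proof -
  let ?S = "\<lambda>u. \<forall>y. 0 \<le> u y \<and> T u y \<le> u y"
  have ne: "{u x | u. ?S u} \<noteq> {}" for x
    using super by blast
  have v_le: "v x \<le> u x" if "?S u" for u x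
    unfolding v_def by (rule cInf_lower) (use that in \<open>auto intro!: bdd_belowI[of _ 0]\<close>)
  have v_ge: "c \<le> v x" if "\<And>u. ?S u \<Longrightarrow> c \<le> u x" for c x
    unfolding v_def by (rule cInf_greatest[OF ne]) (use that in auto)
  show v0: "0 \<le> v x" for x
    by (rule v_ge) blast
  show "v x \<le> u x" if "\<And>y. 0 \<le> u y" "\<And>y. T u y \<le> u y" for u
    using that by (intro v_le) blast
  have T_le: "T v x \<le> v x" for x
  proof (rule v_ge)
    fix u assume u: "?S u"
    have "T v x \<le> T u x" by (intro mono v_le[OF u])
    also have "\<dots> \<le> u x" using u by blast
    finally show "T v x \<le> u x" .
  qed
  moreover have "v x \<le> T v x" for x
    by (rule v_le) (use nonneg v0 mono T_le in blast)
  ultimately show "T v x = v x"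
    by (intro antisym)
qed

text \<open>Rows start at 1, so the axis belongs to the outside, where the walk is killed with value
  0.\<close>

definition box :: "nat \<Rightarrow> nat \<Rightarrow> (int \<times> int) set" where
  "box R M = {- int R..int R} \<times> {1..int M}"

lemma finite_box: "finite (box R M)"
  by (simp add: box_def)

definition slit :: "nat \<Rightarrow> (int \<times> int) set" where
  "slit n = {0} \<times> {1..int n}"

definition height_step :: "nat \<Rightarrow> nat \<Rightarrow> nat \<Rightarrow> (int \<times> int \<Rightarrow> real) \<Rightarrow> int \<times> int \<Rightarrow> real" where
  "height_step R M n u x =
     (if x \<notin> box R M then 0
      else if x \<in> slit n then real_of_int (snd x)
      else (u (x + (1, 0)) + u (x - (1, 0)) + u (x + (0, 1)) + u (x - (0, 1))) / 4)"

text \<open>The least fixed point is the expected height at which the walk, killed on leaving the box,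
  hits the slit.\<close>

definition hit_height :: "nat \<Rightarrow> nat \<Rightarrow> nat \<Rightarrow> int \<times> int \<Rightarrow> real" where
  "hit_height R M n x = Inf {u x | u. \<forall>y. 0 \<le> u y \<and> height_step R M n u y \<le> u y}"

text \<open>The height is harmonic, and no site of the box has a neighbour below the axis, so the
  cutoff at 0 is inactive there. This supplies a supersolution for the fixed point and later bounds
  \<open>hit_height\<close> by the height.\<close>

lemma height_step_super: "height_step R M n (\<lambda>x. max 0 (real_of_int (snd x))) x \<le> max 0 (real_of_int (snd x))"
  by (cases x) (auto simp: height_step_def box_def)

lemma
  shows hit_height_nonneg: "0 \<le> hit_height R M n x"
    and hit_height_fixed: "height_step R M n (hit_height R M n) x = hit_height R M n x"
    and hit_height_least: "\<And>u. (\<And>y. 0 \<le> u y) \<Longrightarrow> (\<And>y. height_step R M n u y \<le> u y)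
           \<Longrightarrow> hit_height R M n x \<le> u x"
proof -
  have mono: "height_step R M n u x \<le> height_step R M n w x" if "\<And>x. u x \<le> w x" for u w x
    unfolding height_step_def by (auto intro!: divide_right_mono add_mono that)
  have nonneg: "0 \<le> height_step R M n u x" if "\<And>x. 0 \<le> u x" for u x
    unfolding height_step_def by (auto simp: box_def intro!: add_nonneg_nonneg that)
  note lfp = least_fixed_point[where T = "height_step R M n" and ?u0.0 = "\<lambda>x. max 0 (real_of_int (snd x))",
      OF mono nonneg _ height_step_super, folded hit_height_def]
  show "0 \<le> hit_height R M n x"
    by (rule lfp(1)) simp_all
  show "height_step R M n (hit_height R M n) x = hit_height R M n x"
    using lfp(2) by (simp add: hit_height_def[abs_def])
  show "hit_height R M n x \<le> u x" if "\<And>y. 0 \<le> u y" "\<And>y. height_step R M n u y \<le> u y" for u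
    by (rule lfp(3)) (simp_all add: that)
qed

lemma hit_height_outside: "x \<notin> box R M \<Longrightarrow> hit_height R M n x = 0"
  using hit_height_fixed[of R M n x] by (simp add: height_step_def)

lemma hit_height_slit: "x \<in> box R M \<Longrightarrow> x \<in> slit n \<Longrightarrow> hit_height R M n x = real_of_int (snd x)"
  using hit_height_fixed[of R M n x] by (simp add: height_step_def)

lemma hit_height_harmonic: "x \<in> box R M \<Longrightarrow> x \<notin> slit n \<Longrightarrow> neg_lap (hit_height R M n) x = 0"
  using hit_height_fixed[of R M n x] by (simp add: height_step_def neg_lap_def)

lemma hit_height_le: "0 \<le> j \<Longrightarrow> hit_height R M n (i, j) \<le> real_of_int j"
  using hit_height_least[of "\<lambda>x. max 0 (real_of_int (snd x))" R M n "(i, j)"] height_step_super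
  by simp

text \<open>Translating the slit of height \<open>n\<close> up by one step and filling in below.\<close>

lemma hit_height_Suc_le:
  assumes "1 \<le> j"
  shows "hit_height R M (Suc n) (i, j) \<le> 1 + hit_height R M n (i, j - 1)"
proof -
  let ?v = "hit_height R M n"
  \<comment> \<open>By minimality of \<open>hit_height\<close> it suffices that this competitor is a
    nonnegative supersolution for the longer slit.\<close>
  define u :: "int \<times> int \<Rightarrow> real" where "u x = (if snd x \<le> 0 then 0 else 1 + ?v (x - (0, 1)))" for x
  have "hit_height R M (Suc n) (i, j) \<le> u (i, j)"
  proof (rule hit_height_least)
    fix y :: "int \<times> int"
    show u0: "0 \<le> u y" for y
      by (simp add: u_def hit_height_nonneg add_nonneg_nonneg)
    obtain k l where y: "y = (k, l)" by (cases y)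
    show "height_step R M (Suc n) u y \<le> u y"
    proof (cases "y \<in> box R M")
      case False
      then show ?thesis using u0[of y] by (simp add: height_step_def)
    next
      case box: True
      then have l: "1 \<le> l" by (simp add: y box_def)
      have zero: "?v (m, 0) = 0" for m
        by (rule hit_height_outside) (simp add: box_def)
      show ?thesis
      proof (cases "y \<in> slit (Suc n)")
        case slit: True
        show ?thesis
        proof (cases "l = 1")
          case True
          then show ?thesis using box slit by (simp add: height_step_def u_def y zero)
        next
          case False
          then have "?v (k, l - 1) = real_of_int (l - 1)"
            using hit_height_slit[of "(k, l - 1)" R M n] box slit l by (simp add: y slit_def box_def)
          then show ?thesis using box slit l by (simp add: height_step_def u_def y)
        qed
      next
        case slit: False
        show ?thesis
        proof (cases "l = 1")
          case True
          \<comment> \<open>In the lowest row \<open>u (k, 1) = 1\<close>, and the neighbours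
            contribute at most \<open>1 + 1 + 2 + 0\<close>; the \<open>2\<close> comes from this
            bound.\<close>
          have "?v (k, 1) \<le> 1" using hit_height_le[of 1 R M n k] by simp
          then show ?thesis using box slit True by (simp add: height_step_def u_def y zero)
        next
          case False
          then have "neg_lap ?v (k, l - 1) = 0"
            using box slit l by (intro hit_height_harmonic) (auto simp: y slit_def box_def)
          then show ?thesis using box slit l False
            by (simp add: height_step_def u_def y neg_lap_Pair)
        qed
      qed
    qed
  qed
  also have "u (i, j) = 1 + ?v (i, j - 1)"
    using assms by (simp add: u_def)
  finally show ?thesis .
qed

section \<open>The gap above the tip: monotonicity and a Harnack bound for the flux\<close>

definition gap :: "nat \<Rightarrow> nat \<Rightarrow> nat \<Rightarrow> real" where
  "gap R M n = real (Suc n) - hit_height R M n (0, int (Suc n))"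

lemma gap_nonneg: "0 \<le> gap R M n"
  using hit_height_le[of "int (Suc n)" R M n 0] by (simp add: gap_def)

lemma gap_Suc_mono: "gap R M n \<le> gap R M (Suc n)"
  using hit_height_Suc_le[of "int n + 2" R M n 0] by (simp add: gap_def algebra_simps)

lemma gap_mono: "m \<le> n \<Longrightarrow> gap R M m \<le> gap R M n"
  by (rule lift_Suc_mono_le[of "gap R M"]) (rule gap_Suc_mono)

text \<open>Let \<open>h\<close> be the height minus \<open>hit_height\<close>. It vanishes at the
  tip and just below, so the flux is the sum of \<open>h\<close> over the other three neighbours. At
  a site where the nonnegative \<open>h\<close> is harmonic, its neighbours have at most 4 times its
  value; the side neighbours are two such steps from \<open>(0, n + 1)\<close>, so
  \<open>33 = 16 + 16 + 1\<close>.\<close>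

lemma flux_tip_le_gap:
  assumes "1 \<le> n" "n + 1 \<le> M" "1 \<le> R"
  shows "neg_lap (hit_height R M n) (0, int n) \<le> 33 * gap R M n"
proof -
  define h where "h x = real_of_int (snd x) - hit_height R M n x" for x
  have h0: "0 \<le> h (i, j)" if "0 \<le> j" for i j
    using hit_height_le[OF that] by (simp add: h_def)
  have harm: "4 * h (i, j) = h (i + 1, j) + h (i - 1, j) + h (i, j + 1) + h (i, j - 1)"
    if "(i, j) \<in> box R M" "(i, j) \<notin> slit n" for i j
    using hit_height_harmonic[OF that] by (simp add: h_def neg_lap_Pair)
  have side: "h (i, int n) \<le> 16 * h (0, int n + 1)" if "i = 1 \<or> i = -1" for i
  proof -
    have "h (i, int n + 1) \<le> 4 * h (0, int n + 1)"
      using harm[of 0 "int n + 1"] assms that h0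
      by (auto simp: box_def slit_def add_nonneg_nonneg)
    moreover have "h (i, int n) \<le> 4 * h (i, int n + 1)"
      using harm[of i "int n + 1"] assms that h0
      by (auto simp: box_def slit_def add_nonneg_nonneg)
    ultimately show ?thesis by linarith
  qed
  have v: "hit_height R M n (0, int n) = real n"
    using hit_height_slit[of "(0, int n)" R M n] assms by (simp add: box_def slit_def)
  have "0 \<le> h (0, int n - 1)" "h (0, int n - 1) = 0"
  proof -
    \<comment> \<open>For \<open>n = 1\<close> this site is on the axis, outside the box, where
      height and \<open>hit_height\<close> are both 0.\<close>
    show "h (0, int n - 1) = 0"
      using hit_height_slit[of "(0, int n - 1)" R M n] hit_height_outside[of "(0, int n - 1)" R M n] assms
      by (cases "n = 1") (simp_all add: box_def slit_def h_def)
    then show "0 \<le> h (0, int n - 1)" by simp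
  qed
  then have "neg_lap (hit_height R M n) (0, int n) = h (1, int n) + h (-1, int n) + h (0, int n + 1)"
    by (simp add: neg_lap_Pair h_def v)
  also have "\<dots> \<le> 33 * h (0, int n + 1)"
    using side[of 1] side[of "-1"] by simp
  finally show ?thesis by (simp add: h_def gap_def add.commute)
qed

section \<open>Energy\<close>

lemma infsum_single:
  fixes f :: "'a \<Rightarrow> real"
  assumes "\<And>x. x \<noteq> y \<Longrightarrow> f x = 0"
  shows "(\<Sum>\<^sub>\<infinity>x. f x) = f y"
proof -
  have "infsum f UNIV = infsum f {y}"
    using assms by (intro infsum_cong_neutral) auto
  then show ?thesis by simp
qed

definition energy :: "nat \<Rightarrow> nat \<Rightarrow> nat \<Rightarrow> real" where
  "energy R M n = (\<Sum>\<^sub>\<infinity>x. hit_height R M n x * neg_lap (hit_height R M n) x)"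

lemma energy_0: "energy R M 0 = 0"
proof -
  have "hit_height R M 0 x * neg_lap (hit_height R M 0) x = 0" for x
    using hit_height_outside[of x R M 0] hit_height_harmonic[of x R M 0]
    by (cases "x \<in> box R M") (auto simp: slit_def)
  then show ?thesis unfolding energy_def by (intro infsum_0)
qed

text \<open>The increment \<open>?d\<close> vanishes off the box and on \<open>slit n\<close>, and
  \<open>neg_lap ?v\<close> vanishes at all other sites, so the two are orthogonal. Against
  \<open>neg_lap ?w\<close> only the new tip survives, where \<open>?d\<close> equals the
  gap.\<close>

lemma energy_Suc:
  assumes "n < M"
  shows "energy R M (Suc n) =
    energy R M n + gap R M n * neg_lap (hit_height R M (Suc n)) (0, int (Suc n))"
proof -
  let ?v = "hit_height R M n" and ?w = "hit_height R M (Suc n)" and ?y = "(0, int (Suc n))"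
  let ?d = "\<lambda>x. ?w x - ?v x"
  note fin = finite_box[of R M] and out = hit_height_outside[of _ R M]
  have s: "(\<lambda>x. hit_height R M k x * g x) summable_on UNIV" for k g
    by (rule finite_support_summable[OF fin]) (simp add: out)
  have y: "?y \<in> box R M" "?y \<in> slit (Suc n)" "?y \<notin> slit n"
    using assms by (auto simp: box_def slit_def)
  have d: "?d x = 0" if "x \<notin> box R M \<or> x \<in> slit n" for x
    using that hit_height_slit[of x R M n] hit_height_slit[of x R M "Suc n"] out[of x]
    by (cases "x \<in> box R M") (auto simp: slit_def)
  have dv: "?d x * neg_lap ?v x = 0" for x
    using d[of x] hit_height_harmonic[of x R M n] by auto
  have "?d x * neg_lap ?w x = 0" if "x \<noteq> ?y" for x
  proof -
    have "x \<in> slit n \<or> x \<notin> slit (Suc n)"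
      using that by (cases x) (auto simp: slit_def)
    then show ?thesis
      using d[of x] hit_height_harmonic[of x R M "Suc n"] by auto
  qed
  then have dw: "(\<Sum>\<^sub>\<infinity>x. ?d x * neg_lap ?w x) = ?d ?y * neg_lap ?w ?y"
    by (rule infsum_single)
  have "energy R M (Suc n) = (\<Sum>\<^sub>\<infinity>x. ?d x * neg_lap ?w x) + (\<Sum>\<^sub>\<infinity>x. ?v x * neg_lap ?w x)"
    unfolding left_diff_distrib by (subst infsum_minus[OF s s]) (simp add: energy_def)
  also have "(\<Sum>\<^sub>\<infinity>x. ?v x * neg_lap ?w x) = (\<Sum>\<^sub>\<infinity>x. ?w x * neg_lap ?v x)"
    by (rule green_identity[OF fin out])
  also have "\<dots> = (\<Sum>\<^sub>\<infinity>x. ?v x * neg_lap ?v x)"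
    using dv by (intro infsum_cong) (simp add: left_diff_distrib)
  finally have "energy R M (Suc n) = ?d ?y * neg_lap ?w ?y + energy R M n"
    unfolding dw energy_def .
  moreover have "?d ?y = gap R M n"
    using hit_height_slit[OF y(1,2)] by (simp add: gap_def)
  ultimately show ?thesis by simp
qed

text \<open>Cauchy-Schwarz against the constant 1: a path of \<open>m\<close> unit edges has
  resistance \<open>m\<close>.\<close>

lemma telescope_square_le:
  fixes f :: "nat \<Rightarrow> real"
  shows "(f 0 - f m)\<^sup>2 \<le> real m * (\<Sum>i<m. (f i - f (Suc i))\<^sup>2)"
  using Cauchy_Schwarz_ineq_sum[of "\<lambda>_. 1" "\<lambda>i. f i - f (Suc i)" "{..<m}"]
  by (simp add: sum_lessThan_telescope')

text \<open>The \<open>n\<close> edge-disjoint paths that lead from \<open>(0, j)\<close> right to \<open>(j, j)\<close> and then down to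
  \<open>(j, 0)\<close> have length \<open>2 j\<close>, and \<open>hit_height\<close> drops by \<open>j\<close> along each of them.\<close>

lemma energy_lower_bound:
  assumes "n \<le> M"
  shows "(real n)\<^sup>2 / 4 \<le> energy R M n"
proof -
  let ?v = "hit_height R M n"
  note fin = finite_box[of R M] and out = hit_height_outside[of _ R M n]
  have form: "energy R M n =
      (\<Sum>\<^sub>\<infinity>x. (?v x - ?v (x + (1, 0)))\<^sup>2) + (\<Sum>\<^sub>\<infinity>x. (?v x - ?v (x + (0, 1)))\<^sup>2)"
    unfolding energy_def by (rule dirichlet_form(1)[OF fin out])
  note summ = dirichlet_form(2)[OF fin out]
  let ?h = "\<lambda>j i. (?v (int i, int j) - ?v (int (Suc i), int j))\<^sup>2"
  let ?k = "\<lambda>j i. (?v (int j, int i) - ?v (int j, int (Suc i)))\<^sup>2"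
  let ?I = "SIGMA j:{1..n}. {..<j}"
  \<comment> \<open>Injectivity expresses edge-disjointness: the horizontal edges in row
    \<open>j\<close> and the vertical ones in column \<open>j\<close> are used by the
    \<open>j\<close>-th path only.\<close>
  have inj: "inj_on (\<lambda>(j, i). (int i, int j)) ?I" "inj_on (\<lambda>(j, i). (int j, int i)) ?I"
    by (auto simp: inj_on_def)
  have "(\<Sum>j=1..n. \<Sum>i<j. ?h j i) = (\<Sum>x\<in>(\<lambda>(j, i). (int i, int j)) ` ?I. (?v x - ?v (x + (1, 0)))\<^sup>2)"
    by (subst sum.reindex[OF inj(1)], subst sum.Sigma) (auto intro!: sum.cong simp: add.commute)
  also have "\<dots> \<le> (\<Sum>\<^sub>\<infinity>x. (?v x - ?v (x + (1, 0)))\<^sup>2)"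
    by (rule finite_sum_le_infsum[OF summ]) auto
  finally have h: "(\<Sum>j=1..n. \<Sum>i<j. ?h j i) \<le> (\<Sum>\<^sub>\<infinity>x. (?v x - ?v (x + (1, 0)))\<^sup>2)" .
  have "(\<Sum>j=1..n. \<Sum>i<j. ?k j i) = (\<Sum>x\<in>(\<lambda>(j, i). (int j, int i)) ` ?I. (?v x - ?v (x + (0, 1)))\<^sup>2)"
    by (subst sum.reindex[OF inj(2)], subst sum.Sigma) (auto intro!: sum.cong simp: add.commute)
  also have "\<dots> \<le> (\<Sum>\<^sub>\<infinity>x. (?v x - ?v (x + (0, 1)))\<^sup>2)"
    by (rule finite_sum_le_infsum[OF summ]) auto
  finally have k: "(\<Sum>j=1..n. \<Sum>i<j. ?k j i) \<le> (\<Sum>\<^sub>\<infinity>x. (?v x - ?v (x + (0, 1)))\<^sup>2)" .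
  have path: "real j / 2 \<le> (\<Sum>i<j. ?h j i) + (\<Sum>i<j. ?k j i)" if j: "j \<in> {1..n}" for j
  proof -
    let ?c = "?v (int j, int j)" and ?s = "(\<Sum>i<j. ?h j i) + (\<Sum>i<j. ?k j i)"
    have "(?v (0, int j) - ?c)\<^sup>2 \<le> real j * (\<Sum>i<j. ?h j i)"
      using telescope_square_le[of "\<lambda>i. ?v (int i, int j)" j] by simp
    moreover have "?v (0, int j) = real j"
      using hit_height_slit[of "(0, int j)" R M n] j assms by (simp add: box_def slit_def)
    moreover have "(?v (int j, 0) - ?c)\<^sup>2 \<le> real j * (\<Sum>i<j. ?k j i)"
      using telescope_square_le[of "\<lambda>i. ?v (int j, int i)" j] by simp
    moreover have "?v (int j, 0) = 0"
      by (rule out) (simp add: box_def)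
    ultimately have "(real j - ?c)\<^sup>2 + ?c\<^sup>2 \<le> real j * ?s"
      by (simp add: distrib_left)
    \<comment> \<open>The unknown corner value \<open>?c\<close> costs least at
      \<open>j / 2\<close>.\<close>
    moreover have "(real j)\<^sup>2 / 2 \<le> (real j - ?c)\<^sup>2 + ?c\<^sup>2"
      using zero_le_power2[of "real j - 2 * ?c"] by (simp add: power2_eq_square algebra_simps)
    ultimately have "real j * (real j / 2) \<le> real j * ?s"
      by (simp add: power2_eq_square)
    then show ?thesis using j by (simp only: mult_le_cancel_left) auto
  qed
  have "(\<Sum>j=1..n. real j) = real n * (real n + 1) / 2"
    by (induction n) (simp_all add: field_simps)
  then have "(real n)\<^sup>2 / 4 \<le> (\<Sum>j=1..n. real j / 2)"
    by (simp add: power2_eq_square field_simps flip: sum_divide_distrib)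
  also have "\<dots> \<le> (\<Sum>j=1..n. (\<Sum>i<j. ?h j i) + (\<Sum>i<j. ?k j i))"
    by (intro sum_mono path)
  also have "\<dots> \<le> energy R M n"
    unfolding form sum.distrib using h k by (rule add_mono)
  finally show ?thesis .
qed

lemma gap_lower_bound:
  assumes "n < M" "1 \<le> R"
  shows "sqrt (real n) / 12 \<le> gap R M n"
proof (cases "n = 0")
  case True
  then show ?thesis by (simp add: gap_nonneg)
next
  case False
  let ?a = "gap R M n"
  \<comment> \<open>Each energy increment is a gap times a flux, both controlled by the final gap
    through monotonicity, so it is at most \<open>33 * ?a\<^sup>2\<close>.\<close>
  have "m \<le> n \<Longrightarrow> energy R M m \<le> 33 * real m * ?a\<^sup>2" for m
  proof (induction m)
    case 0
    then show ?case by (simp add: energy_0)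
  next
    case (Suc m)
    have "neg_lap (hit_height R M (Suc m)) (0, int (Suc m)) \<le> 33 * gap R M (Suc m)"
      by (rule flux_tip_le_gap) (use Suc.prems assms in auto)
    also have "\<dots> \<le> 33 * ?a"
      using gap_mono[OF Suc.prems] by simp
    finally have "gap R M m * neg_lap (hit_height R M (Suc m)) (0, int (Suc m)) \<le> gap R M m * (33 * ?a)"
      by (intro mult_left_mono gap_nonneg)
    also have "\<dots> \<le> ?a * (33 * ?a)"
      using gap_mono[of m n R M] Suc.prems by (intro mult_right_mono) (auto simp: gap_nonneg)
    finally show ?case
      using Suc energy_Suc[of m M R] assms by (simp add: power2_eq_square algebra_simps)
  qed
  from this[OF order_refl] energy_lower_bound[of n M R] assms
  \<comment> \<open>Here \<open>132 = 4 * 33\<close>, rounded up below to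
    \<open>12\<^sup>2\<close>.\<close>
  have "real n * real n \<le> real n * (132 * ?a\<^sup>2)"
    by (simp add: power2_eq_square)
  then have "real n \<le> 132 * ?a\<^sup>2"
    using False by simp
  also have "\<dots> \<le> (12 * ?a)\<^sup>2"
    by (simp add: power2_eq_square)
  finally have "sqrt (real n) \<le> 12 * ?a"
    using gap_nonneg by (intro real_le_lsqrt) simp_all
  then show ?thesis by simp
qed

section \<open>Comparison with the hitting probability\<close>

text \<open>Green's identity makes the sum of \<open>F * neg_lap \<psi>\<close> nonnegative. Off
  \<open>U\<close> this product is at most \<open>2 * F\<close> on \<open>B\<close> and at most 0
  elsewhere. On \<open>U\<close>, where \<open>\<psi>\<close> has its minimum 0, it is nonpositive,
  and at \<open>y\<close> it is at most \<open>- \<psi> (y + (0, 1))\<close> because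
  \<open>F y = 1\<close>.\<close>

lemma supersolution_test:
  fixes F \<psi> :: "int \<times> int \<Rightarrow> real"
  assumes fin: "finite A" "\<And>x. x \<notin> A \<Longrightarrow> \<psi> x = 0"
    and \<psi>: "\<And>x. 0 \<le> \<psi> x" "\<And>x. x \<in> U \<Longrightarrow> \<psi> x = 0"
    and F: "\<And>x. 0 \<le> F x" "\<And>x. x \<notin> U \<Longrightarrow> 0 \<le> neg_lap F x"
    and y: "y \<in> U" "F y = 1" "y \<notin> B"
    and sub: "\<And>x. x \<notin> U \<Longrightarrow> neg_lap \<psi> x \<le> 2 * indicator B x"
    and B: "finite B"
  shows "\<psi> (y + (0, 1)) \<le> 2 * (\<Sum>x\<in>B. F x)"
proof -
  let ?G = "\<lambda>x. F x * neg_lap \<psi> x"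
  have "0 \<le> (\<Sum>\<^sub>\<infinity>x. \<psi> x * neg_lap F x)"
    by (intro infsum_nonneg) (metis F(2) \<psi> mult_nonneg_nonneg mult_zero_left order_refl)
  also have "\<dots> = (\<Sum>\<^sub>\<infinity>x. ?G x)"
    by (rule green_identity[OF fin])
  also have "\<dots> \<le> (\<Sum>\<^sub>\<infinity>x. indicator (insert y B) x * (if x = y then - \<psi> (y + (0, 1)) else 2 * F x))"
  proof (rule infsum_mono)
    show "?G summable_on UNIV"
      by (rule summable_neg_lap_mult[OF fin])
    show "(\<lambda>x. indicator (insert y B) x * (if x = y then - \<psi> (y + (0, 1)) else 2 * F x)) summable_on UNIV"
      by (rule finite_support_summable[of "insert y B"]) (use B in auto)
    fix x
    show "?G x \<le> indicator (insert y B) x * (if x = y then - \<psi> (y + (0, 1)) else 2 * F x)"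
    proof (cases "x \<in> U")
      case True
      have neg: "neg_lap \<psi> x \<le> - \<psi> (x + (0, 1))"
        using \<psi>(1)[of "x + (1, 0)"] \<psi>(1)[of "x - (1, 0)"] \<psi>(1)[of "x - (0, 1)"] \<psi>(2)[OF True]
        by (simp add: neg_lap_def)
      show ?thesis
      proof (cases "x = y")
        case True
        then show ?thesis using neg y by simp
      next
        case False
        have "?G x \<le> 0"
          using neg \<psi>(1)[of "x + (0, 1)"] F(1)[of x] by (intro mult_nonneg_nonpos) auto
        then show ?thesis using False F(1)[of x] by (auto simp: indicator_def)
      qed
    next
      case False
      then show ?thesis
        using mult_left_mono[OF sub[OF False] F(1)[of x]] y by (auto simp: indicator_def mult.commute)
    qed
  qed
  also have "\<dots> = (\<Sum>x\<in>insert y B. if x = y then - \<psi> (y + (0, 1)) else 2 * F x)"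
  proof -
    have "(\<Sum>\<^sub>\<infinity>x. indicator (insert y B) x * (if x = y then - \<psi> (y + (0, 1)) else 2 * F x)) =
        (\<Sum>\<^sub>\<infinity>x\<in>insert y B. if x = y then - \<psi> (y + (0, 1)) else 2 * F x)"
      by (rule infsum_cong_neutral) auto
    then show ?thesis using B by simp
  qed
  also have "\<dots> = - \<psi> (y + (0, 1)) + (\<Sum>x\<in>B. 2 * F x)"
    using B y by (auto intro!: sum.cong)
  finally show ?thesis by (simp add: sum_distrib_left)
qed

text \<open>A tent of height \<open>N\<close> in the vertical direction plus a small harmonic quadratic polynomial
  which is nonpositive on the slit and makes the function nonpositive on the outer boundary of
  \<open>box (7 * N) (3 * N - 1)\<close>.\<close>

definition barrier :: "nat \<Rightarrow> nat \<Rightarrow> int \<times> int \<Rightarrow> real" where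
  "barrier n N x = real N - \<bar>real_of_int (snd x) - real N\<bar>
     - ((real_of_int (fst x))\<^sup>2 - (real_of_int (snd x))\<^sup>2 + real n * real_of_int (snd x)) / (24 * real N)"

text \<open>The tent bends only on row \<open>N\<close>, by 2; \<open>i\<^sup>2 - j\<^sup>2\<close>
  and \<open>j\<close> are harmonic on the lattice.\<close>

lemma neg_lap_barrier:
  "neg_lap (barrier n N) x = 2 * indicator (L_line N) x"
proof -
  obtain i j where x: "x = (i, j)" by (cases x)
  define a b where "a = real_of_int i" and "b = real_of_int j"
  have "\<bar>b + 1 - real N\<bar> + \<bar>b - 1 - real N\<bar> - 2 * \<bar>b - real N\<bar> = 2 * indicator (L_line N) x"
  proof -
    consider "j = int N" | "j \<le> int N - 1" | "j \<ge> int N + 1" by linarith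
    then show ?thesis
      by cases (auto simp: L_line_def indicator_def x b_def)
  qed
  moreover have "4 * (a\<^sup>2 - b\<^sup>2 + real n * b) =
      ((a + 1)\<^sup>2 - b\<^sup>2 + real n * b) + ((a - 1)\<^sup>2 - b\<^sup>2 + real n * b)
      + (a\<^sup>2 - (b + 1)\<^sup>2 + real n * (b + 1)) + (a\<^sup>2 - (b - 1)\<^sup>2 + real n * (b - 1))"
    by (simp add: power2_eq_square algebra_simps)
  from arg_cong[OF this, of "\<lambda>t. t / (24 * real N)"]
  have "4 * ((a\<^sup>2 - b\<^sup>2 + real n * b) / (24 * real N)) =
      ((a + 1)\<^sup>2 - b\<^sup>2 + real n * b) / (24 * real N) + ((a - 1)\<^sup>2 - b\<^sup>2 + real n * b) / (24 * real N)
      + (a\<^sup>2 - (b + 1)\<^sup>2 + real n * (b + 1)) / (24 * real N)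
      + (a\<^sup>2 - (b - 1)\<^sup>2 + real n * (b - 1)) / (24 * real N)"
    by (simp only: times_divide_eq_right flip: add_divide_distrib)
  ultimately show ?thesis
    unfolding x neg_lap_Pair barrier_def by (simp add: a_def b_def)
qed

text \<open>On the axis the tent is 0 and the subtracted quotient nonnegative. On row
  \<open>3 * N\<close> the tent is \<open>- N\<close>, against a gain of at most
  \<open>9 * N / 24\<close>. Where \<open>\<bar>i\<bar> \<ge> 7 * N\<close>, the subtracted quotient
  is at least \<open>(49 - 9) * N / 24\<close>, more than the tent's height
  \<open>N\<close>.\<close>

lemma barrier_outside:
  assumes N: "0 < N" and j: "0 \<le> j" "j \<le> 3 * int N"
    and out: "(i, j) \<notin> box (7 * N) (3 * N - 1)"
  shows "barrier n N (i, j) \<le> 0"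
proof -
  define a b m where "a = real_of_int i" and "b = real_of_int j" and "m = real N"
  have m: "0 < m" using N by (simp add: m_def)
  have b: "0 \<le> b" "b \<le> 3 * m"
    using j by (simp_all add: b_def m_def)
  have b2: "b\<^sup>2 \<le> 9 * m\<^sup>2"
    using power_mono[OF b(2) b(1), of 2] by (simp add: power_mult_distrib)
  have nb: "0 \<le> real n * b" using b by simp
  have eq: "barrier n N (i, j) = m - \<bar>b - m\<bar> - (a\<^sup>2 - b\<^sup>2 + real n * b) / (24 * m)"
    by (simp add: barrier_def a_def b_def m_def)
  have "j \<le> 0 \<or> j = 3 * int N \<or> 7 * int N \<le> \<bar>i\<bar>"
    using out j N by (auto simp: box_def of_nat_diff)
  then consider "b = 0" | "b = 3 * m" | "7 * m \<le> \<bar>a\<bar>"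
  proof (elim disjE)
    assume "7 * int N \<le> \<bar>i\<bar>"
    then have "real_of_int (7 * int N) \<le> real_of_int \<bar>i\<bar>" by (simp only: of_int_le_iff)
    then show ?thesis using that by (simp add: a_def m_def)
  qed (use that j in \<open>auto simp: b_def m_def\<close>)
  then show ?thesis
  proof cases
    case 1
    then show ?thesis using m by (simp add: eq)
  next
    case 2
    have "(m - \<bar>b - m\<bar>) * (24 * m) \<le> a\<^sup>2 - b\<^sup>2 + real n * b"
    proof -
      have "(m - \<bar>b - m\<bar>) * (24 * m) = - 24 * m\<^sup>2"
        using 2 m by (simp add: power2_eq_square)
      then show ?thesis using b2 nb zero_le_power2[of a] zero_le_power2[of m] by linarith
    qed
    then show ?thesis using m by (simp add: eq field_simps)
  next
    case 3
    have "(7 * m)\<^sup>2 \<le> \<bar>a\<bar>\<^sup>2" using 3 m by (intro power_mono) auto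
    then have "49 * m\<^sup>2 \<le> a\<^sup>2" by (simp add: power_mult_distrib)
    moreover have "(m - \<bar>b - m\<bar>) * (24 * m) \<le> m * (24 * m)"
      using m by (intro mult_right_mono) auto
    moreover have "m * (24 * m) = 24 * m\<^sup>2"
      by (simp add: power2_eq_square)
    ultimately have "(m - \<bar>b - m\<bar>) * (24 * m) \<le> a\<^sup>2 - b\<^sup>2 + real n * b"
      using b2 nb zero_le_power2[of m] by linarith
    then show ?thesis using m by (simp add: eq field_simps)
  qed
qed

text \<open>Below row \<open>N\<close> the tent is the height itself. The linear term of the
  polynomial makes the subtracted \<open>real n * b - b\<^sup>2\<close> nonnegative for
  \<open>0 \<le> b \<le> n\<close>.\<close>

lemma barrier_slit:
  assumes "n < N" "x \<in> slit n"
  shows "barrier n N x \<le> real_of_int (snd x)"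
proof -
  obtain j where x: "x = (0, j)" and j: "1 \<le> j" "j \<le> int n"
    using assms by (cases x) (auto simp: slit_def)
  define b where "b = real_of_int j"
  have b: "0 \<le> b" "b \<le> real n"
    using j by (simp_all add: b_def)
  have "b * b \<le> real n * b" using b by (intro mult_right_mono) auto
  then have "0 \<le> (real n * b - b\<^sup>2) / (24 * real N)"
    by (simp add: power2_eq_square)
  then show ?thesis
    using b assms by (simp add: barrier_def x flip: b_def)
qed

lemma hit_prob_sum_lower_bound:
  assumes nN: "n < N"
  defines "F \<equiv> \<lambda>x. enn2real (hit_prob (U_set n) (y_tip n) x)"
  shows "sqrt (real n) / 24 \<le> (\<Sum>x\<in>{- int (7 * N)..int (7 * N)} \<times> {int N}. F x)"
proof -
  let ?R = "7 * N" and ?M = "3 * N - 1"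
  let ?v = "hit_height ?R ?M n" and ?\<beta> = "barrier n N"
  let ?B = "{- int ?R..int ?R} \<times> {int N}"
  define \<psi> where "\<psi> x = (if x \<in> box ?R ?M then max 0 (?\<beta> x - ?v x) else 0)" for x
  have \<psi>0: "0 \<le> \<psi> x" for x by (simp add: \<psi>_def)
  \<comment> \<open>Outside the box the barrier is nonpositive and \<open>?v\<close> nonnegative, so
    the bound covers all neighbours of a box site.\<close>
  have \<psi>_ge: "?\<beta> (i, j) - ?v (i, j) \<le> \<psi> (i, j)" if "0 \<le> j" "j \<le> 3 * int N" for i j
    using barrier_outside[of N j i n] that nN hit_height_nonneg[of ?R ?M n "(i, j)"]
    by (auto simp: \<psi>_def)
  have sub: "neg_lap \<psi> x \<le> 2 * indicator ?B x" if x: "x \<notin> U_set n" for x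
  proof -
    obtain i j where ij: "x = (i, j)" by (cases x)
    have ind: "0 \<le> (indicator ?B x :: real)" by simp
    show ?thesis
    proof (cases "\<psi> x = 0")
      case True
      then have "neg_lap \<psi> x \<le> 0"
        using \<psi>0[of "x + (1, 0)"] \<psi>0[of "x - (1, 0)"] \<psi>0[of "x + (0, 1)"] \<psi>0[of "x - (0, 1)"]
        by (simp add: neg_lap_def)
      then show ?thesis using ind by linarith
    next
      case False
      then have box: "x \<in> box ?R ?M" and eq: "\<psi> x = ?\<beta> x - ?v x"
        by (auto simp: \<psi>_def max_def split: if_splits)
      have "x \<notin> slit n"
        using x by (auto simp: slit_def U_set_def V_seg_def) (metis nat_0_le nat_le_iff order_trans zero_le_one)
      then have "neg_lap ?v x = 0"
        by (intro hit_height_harmonic box)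
      \<comment> \<open>Where \<open>\<psi>\<close> is positive it equals
        \<open>?\<beta> - ?v\<close>, and it dominates that function at the four neighbours, so its
        \<open>neg_lap\<close> is no larger.\<close>
      moreover have "1 \<le> j" "j + 1 \<le> 3 * int N"
        using box nN by (auto simp: ij box_def of_nat_diff)
      then have "neg_lap \<psi> x \<le> neg_lap ?\<beta> x - neg_lap ?v x"
        using \<psi>_ge[of j "i + 1"] \<psi>_ge[of j "i - 1"] \<psi>_ge[of "j + 1" i] \<psi>_ge[of "j - 1" i] eq
        unfolding ij neg_lap_Pair by simp
      moreover have "indicator (L_line N) x \<le> (indicator ?B x :: real)"
        using box by (auto simp: ij box_def L_line_def indicator_def)
      ultimately show ?thesis
        by (simp add: neg_lap_barrier)
    qed
  qed
  have "\<psi> (y_tip n + (0, 1)) \<le> 2 * (\<Sum>x\<in>?B. F x)"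
  proof (rule supersolution_test[OF finite_box])
    show "\<psi> x = 0" if "x \<notin> box ?R ?M" for x using that by (simp add: \<psi>_def)
    show "0 \<le> \<psi> x" for x by (rule \<psi>0)
    show "\<psi> x = 0" if "x \<in> U_set n" for x
    proof (cases "x \<in> box ?R ?M")
      case True
      then have "x \<in> slit n"
        using that by (auto simp: U_set_def V_seg_def L_line_def slit_def box_def)
      then show ?thesis
        using barrier_slit[OF nN] hit_height_slit[OF True] True by (simp add: \<psi>_def)
    qed (simp add: \<psi>_def)
    show "0 \<le> F x" for x by (simp add: F_def)
    show "0 \<le> neg_lap F x" if "x \<notin> U_set n" for x
      using enn2real_hit_prob_harmonic[OF that, of "y_tip n"] by (simp add: F_def neg_lap_def)
    show "y_tip n \<in> U_set n" by (rule y_tip_in_U_set)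
    show "F (y_tip n) = 1" by (simp add: F_def hit_prob_self y_tip_in_U_set)
    show "y_tip n \<notin> ?B" using nN by (simp add: y_tip_def)
    show "neg_lap \<psi> x \<le> 2 * indicator ?B x" if "x \<notin> U_set n" for x using that by (rule sub)
    show "finite ?B" by simp
  qed
  moreover have "gap ?R ?M n \<le> \<psi> (y_tip n + (0, 1))"
  proof -
    have "real n + 1 \<le> real N" using nN by linarith
    then have abs: "\<bar>real n + 1 - real N\<bar> = real N - (real n + 1)"
      by simp
    \<comment> \<open>One step beyond the tip the polynomial has changed sign, being
      \<open>- (n + 1)\<close>, so the barrier is at least the height there.\<close>
    have "real n * (real n + 1) - (real n + 1)\<^sup>2 \<le> 0"
      by (simp add: power2_eq_square algebra_simps)
    then have "(real n * (real n + 1) - (real n + 1)\<^sup>2) / (24 * real N) \<le> 0"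
      by (simp add: divide_nonpos_nonneg)
    moreover have "?\<beta> (0, int n + 1) = real N - \<bar>real n + 1 - real N\<bar>
        - (real n * (real n + 1) - (real n + 1)\<^sup>2) / (24 * real N)"
      by (simp add: barrier_def)
    ultimately have "real n + 1 \<le> ?\<beta> (0, int n + 1)"
      unfolding abs by linarith
    then show ?thesis
      using \<psi>_ge[of "int n + 1" 0] nN by (simp add: gap_def y_tip_def add.commute)
  qed
  moreover have "sqrt (real n) / 12 \<le> gap ?R ?M n"
    by (rule gap_lower_bound) (use nN in auto)
  ultimately show ?thesis by simp
qed

section \<open>From a finite segment to the whole line\<close>

theorem theorem2:
  "\<exists>c::real. c > 0 \<and>
     (\<forall>n N :: nat. N > n \<longrightarrow> H_sum (U_set n) N (y_tip n) \<ge> ennreal (c * sqrt (real n)))"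
proof (intro exI conjI allI impI)
  \<comment> \<open>Half of the \<open>1 / 12\<close> in \<open>gap_lower_bound\<close>; the factor
    2 is the kink of the barrier.\<close>
  show "0 < (1 / 24 :: real)" by simp
  fix n N :: nat
  assume nN: "n < N"
  let ?U = "U_set n" and ?B = "{- int (7 * N)..int (7 * N)} \<times> {int N}"
  show "ennreal (1 / 24 * sqrt (real n)) \<le> H_sum ?U N (y_tip n)"
  proof -
    have "?U \<union> L_line 0 = ?U"
      by (auto simp: U_set_def)
    then have H: "H_sum ?U N (y_tip n) = (\<Sum>\<^sub>\<infinity>z\<in>L_line N - ?U. hit_prob ?U (y_tip n) z)"
      by (simp add: H_sum_def hit_prob_def)
    have "1 / 24 * sqrt (real n) \<le> (\<Sum>z\<in>?B. enn2real (hit_prob ?U (y_tip n) z))"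
      using hit_prob_sum_lower_bound[OF nN] by simp
    then have "ennreal (1 / 24 * sqrt (real n)) \<le> (\<Sum>z\<in>?B. ennreal (enn2real (hit_prob ?U (y_tip n) z)))"
      by (subst sum_ennreal) (auto intro: ennreal_leI)
    also have "\<dots> = (\<Sum>z\<in>?B. hit_prob ?U (y_tip n) z)"
    proof (intro sum.cong refl ennreal_enn2real)
      show "hit_prob ?U (y_tip n) z < top" for z
        using hit_prob_le_1[of ?U "y_tip n" z] by (simp add: le_less_trans)
    qed
    \<comment> \<open>Since \<open>n < N\<close>, the segment \<open>?B\<close> lies in
      \<open>L_line N - ?U\<close>, and the infinite sum is the supremum of its finite partial
      sums.\<close>
    also have "\<dots> \<le> (\<Sum>\<^sub>\<infinity>z\<in>L_line N - ?U. hit_prob ?U (y_tip n) z)"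
      using nN unfolding nonneg_infsum_complete[OF zero_le]
      by (intro SUP_upper) (auto simp: L_line_def U_set_def V_seg_def)
    finally show ?thesis
      unfolding H .
  qed
qed

end
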